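(* Consider a Boolean control network $x(t+1)=Lu(t)x(t)$, $y(t)=Hx(t)$ ($t=0,1,\dots$) with states $x(t)\in\Delta_N$, inputs $u(t)\in\Delta_M$, outputs $y(t)\in\Delta_Q$, where $L\in\mathcal{L}_{N\times(NM)}$ and $H\in\mathcal{L}_{Q\times N}$. The Boolean control network is not reconstructible if and only if its weighted pair graph has a complete subgraph.
   Context: Notation. $\delta_n^i$ is the $i$-th column of the $n\times n$ identity matrix and $\Delta_n=\{\delta_n^1,\dots,\delta_n^n\}$. $\mathcal{L}_{n\times s}$ is the set of $n\times s$ matrices all of whose columns lie in $\Delta_n$ (logical matrices). $N,M,Q$ are positive integers (for a genuine Boolean network with $n$ state, $m$ input and $q$ output nodes, $N=2^n$, $M=2^m$, $Q=2^q$, but arbitrary positive integers are allowed). Products are semi-tensor products; concretely, for $u\in\Delta_M$, $x\in\Delta_N$, $Lux=L(u\otimes x)\in\Delta_N$ with $\otimes$ the Kronecker product, so $L\delta_M^j\delta_N^i$ is column $(j-1)N+i$ of $L$; $Hx$ is the usual matrix product. $(\Delta_M)^p$ is the set of words of length $p$ over $\Delta_M$ (for $p=0$ it contains only the empty word); $\mathbb{N}$ includes $0$. Trajectories. For $x_0\in\Delta_N$, $p\in\mathbb{N}$ and $U=u_0\dots u_{p-1}\in(\Delta_M)^p$, let $x_{i+1}=Lu_ix_i$ for $0\le i<p$ and $y_i=Hx_i$ for $0\le i\le p$. Put $L_{x_0}^p(U)=x_0x_1\dots x_p$, $(HL)_{x_0}^p(U)=y_0y_1\dots y_p$, and let $L_{x_0}^p(U)[i]=x_i$.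 Reconstructibility. The network is called reconstructible if there are $p\in\mathbb{N}$ and $U\in(\Delta_M)^p$ such that for all different $x_0,\bar x_0\in\Delta_N$, $L_{x_0}^p(U)[p]\ne L_{\bar x_0}^p(U)[p]$ implies $(HL)_{x_0}^p(U)\ne(HL)_{\bar x_0}^p(U)$. Weighted pair graph. It is the weighted directed graph $\mathcal{G}=(\mathcal{V},\mathcal{E},\mathcal{W},2^{\Delta_M})$ with vertex set $\mathcal{V}=\{\{x,x'\}\mid x,x'\in\Delta_N,\ x\ne x',\ Hx=Hx'\}$ (unordered pairs). For $\{x_1,x_1'\},\{x_2,x_2'\}\in\mathcal{V}$, the pair $(\{x_1,x_1'\},\{x_2,x_2'\})$ is in the edge set $\mathcal{E}\subset\mathcal{V}\times\mathcal{V}$ iff there exists $u\in\Delta_M$ such that ($Lux_1=x_2$ and $Lux_1'=x_2'$) or ($Lux_1=x_2'$ and $Lux_1'=x_2$); the weight $\mathcal{W}(e)\subset\Delta_M$ of such an edge $e$ is the set of all such $u$. Complete subgraph. A subgraph of $\mathcal{G}$ is the graph generated by a nonempty set of vertices $\mathcal{V}'\subset\mathcal{V}$: its edge set is $\mathcal{E}'=(\mathcal{V}'\times\mathcal{V}')\cap\mathcal{E}$, with the weights inherited from $\mathcal{G}$. The outdegree of a vertex $v$ in this subgraph is $\left|\bigcup_{w\in\mathcal{V}',\,(v,w)\in\mathcal{E}'}\mathcal{W}((v,w))\right|$. The subgraph is complete if each of its vertices has outdegree $|\Delta_M|=M$ in the subgraph. *)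

theory Defs
  imports "Jordan_Normal_Form.Matrix"
begin

definition Delta :: "nat \<Rightarrow> real vec set" where
  "Delta n = {col (1\<^sub>m n) i | i. i < n}"

definition logical_mats :: "nat \<Rightarrow> nat \<Rightarrow> real mat set" where
  "logical_mats n s = {A \<in> carrier_mat n s. set (cols A) \<subseteq> Delta n}"

definition kron_vec :: "real vec \<Rightarrow> real vec \<Rightarrow> real vec" (infixr "\<otimes>\<^sub>k" 70) where
  "u \<otimes>\<^sub>k x = vec (dim_vec u * dim_vec x) (\<lambda>k. u $ (k div dim_vec x) * x $ (k mod dim_vec x))"

definition step :: "real mat \<Rightarrow> real vec \<Rightarrow> real vec \<Rightarrow> real vec" where
  "step L u x = L *\<^sub>v (u \<otimes>\<^sub>k x)"

text \<open>Indices are 0-based here, so this is the usual formula that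
  \<open>L \<delta>\<^sub>M\<^sup>j \<delta>\<^sub>N\<^sup>i\<close> is column \<open>(j - 1) N + i\<close> of \<open>L\<close>.\<close>

lemma step_col:
  assumes L: "L \<in> carrier_mat n (N * M)" and j: "j < M" and i: "i < N"
  shows "step L (col (1\<^sub>m M) j) (col (1\<^sub>m N) i) = col L (j * N + i)"
proof -
  have "j * N + i < Suc j * N" using i by simp
  also have "\<dots> \<le> M * N" using j by (intro mult_le_mono1) simp
  finally have lt: "j * N + i < M * N" .
  have "k = j * N + i" if "k div N = j" "k mod N = i" for k
    using that div_mult_mod_eq[of k N] by simp
  moreover have "k div N < M" if "k < M * N" for k
    using that by (simp add: less_mult_imp_div_less)
  ultimately have "col (1\<^sub>m M) j \<otimes>\<^sub>k col (1\<^sub>m N) i = unit_vec (N * M) (j * N + i)"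
    using i j lt by (intro eq_vecI) (auto simp: kron_vec_def unit_vec_def mult.commute)
  then show ?thesis
    using L lt by (intro eq_vecI) (auto simp: step_def mult.commute)
qed

fun state_traj :: "real mat \<Rightarrow> real vec \<Rightarrow> real vec list \<Rightarrow> real vec list" where
  "state_traj L x [] = [x]"
| "state_traj L x (u # U) = x # state_traj L (step L u x) U"

definition output_traj :: "real mat \<Rightarrow> real mat \<Rightarrow> real vec \<Rightarrow> real vec list \<Rightarrow> real vec list" where
  "output_traj H L x U = map (\<lambda>z. H *\<^sub>v z) (state_traj L x U)"

definition words :: "'a set \<Rightarrow> nat \<Rightarrow> 'a list set" where
  "words A p = {U. set U \<subseteq> A \<and> length U = p}"

definition reconstructible :: "nat \<Rightarrow> nat \<Rightarrow> real mat \<Rightarrow> real mat \<Rightarrow> bool" where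
  "reconstructible N M L H \<longleftrightarrow>
     (\<exists>p. \<exists>U \<in> words (Delta M) p. \<forall>x \<in> Delta N. \<forall>x' \<in> Delta N. x \<noteq> x' \<longrightarrow>
        state_traj L x U ! p \<noteq> state_traj L x' U ! p \<longrightarrow>
        output_traj H L x U \<noteq> output_traj H L x' U)"

text \<open>Edges are weighted by subsets of \<open>letters\<close>. The values of \<open>weight\<close> outside \<open>edges\<close>
  are irrelevant.\<close>

record ('v, 'a) wgraph =
  verts :: "'v set"
  edges :: "('v \<times> 'v) set"
  weight :: "'v \<times> 'v \<Rightarrow> 'a set"
  letters :: "'a set"

definition subgraph_on :: "('v, 'a) wgraph \<Rightarrow> 'v set \<Rightarrow> ('v, 'a) wgraph" where
  "subgraph_on G V' = G\<lparr>verts := V', edges := (V' \<times> V') \<inter> edges G\<rparr>"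

definition outdegree :: "('v, 'a) wgraph \<Rightarrow> 'v \<Rightarrow> nat" where
  "outdegree G v = card (\<Union>w \<in> {w \<in> verts G. (v, w) \<in> edges G}. weight G (v, w))"

definition complete_wgraph :: "('v, 'a) wgraph \<Rightarrow> bool" where
  "complete_wgraph G \<longleftrightarrow> (\<forall>v \<in> verts G. outdegree G v = card (letters G))"

definition has_complete_subgraph :: "('v, 'a) wgraph \<Rightarrow> bool" where
  "has_complete_subgraph G \<longleftrightarrow>
     (\<exists>V'. V' \<subseteq> verts G \<and> V' \<noteq> {} \<and> complete_wgraph (subgraph_on G V'))"

definition pair_verts :: "nat \<Rightarrow> real mat \<Rightarrow> real vec set set" where
  "pair_verts N H = {{x, x'} | x x'. x \<in> Delta N \<and> x' \<in> Delta N \<and> x \<noteq> x' \<and> H *\<^sub>v x = H *\<^sub>v x'}"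

text \<open>The condition below does not depend on how the unordered pairs \<open>v\<close> and \<open>w\<close> are
  written, so choosing representatives is harmless.\<close>

definition pair_step :: "real mat \<Rightarrow> real vec \<Rightarrow> real vec set \<Rightarrow> real vec set \<Rightarrow> bool" where
  "pair_step L u v w \<longleftrightarrow>
     (\<exists>x\<^sub>1 x\<^sub>1' x\<^sub>2 x\<^sub>2'. v = {x\<^sub>1, x\<^sub>1'} \<and> w = {x\<^sub>2, x\<^sub>2'} \<and>
        (step L u x\<^sub>1 = x\<^sub>2 \<and> step L u x\<^sub>1' = x\<^sub>2' \<or>
         step L u x\<^sub>1 = x\<^sub>2' \<and> step L u x\<^sub>1' = x\<^sub>2))"

definition weighted_pair_graph ::
  "nat \<Rightarrow> nat \<Rightarrow> real mat \<Rightarrow> real mat \<Rightarrow> (real vec set, real vec) wgraph" where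
  "weighted_pair_graph N M L H =
     \<lparr>verts = pair_verts N H,
      edges = {(v, w). v \<in> pair_verts N H \<and> w \<in> pair_verts N H \<and> (\<exists>u \<in> Delta M. pair_step L u v w)},
      weight = (\<lambda>(v, w). {u \<in> Delta M. pair_step L u v w}),
      letters = Delta M\<rparr>"

end

theory Submission
  imports Defs
begin

text \<open>
  Under an input word two distinct states either stay \<^emph>\<open>confused\<close> (their outputs agree all along
  and they are still distinct at the end) or get resolved. Once resolved they remain so under every
  longer word: differing outputs are never forgotten, and merged states never split again. The
  network is reconstructible iff a single word resolves all pairs of states.

  On unordered pairs the dynamics is deterministic, so outdegree \<open>|\<Delta>\<^sub>M|\<close> just says that
  every input leads back into the subgraph. A complete subgraph is therefore a nonempty set of
  vertices \<open>{x, x'}\<close> that is closed under taking the image by any input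
  (\<open>has_complete_subgraph_iff\<close>).

  Starting inside such a closed set, no word can resolve the pair, so the network is not
  reconstructible. Conversely, the pairs that no word resolves form a closed set. If that set is
  empty, every pair has its own resolving word, and since resolution is permanent these words can
  be concatenated: process the finitely many pairs one at a time, appending a word that resolves
  wherever the current pair has been driven (\<open>common_resolving_word\<close>). The result
  resolves everything, so a network that is not reconstructible has a nonempty closed set.
\<close>

section \<open>Unit vectors and logical matrices\<close>

lemma finite_Delta: "finite (Delta n)"
  by (simp add: Delta_def)

lemma step_in_Delta:
  assumes L: "L \<in> logical_mats N (N * M)" and u: "u \<in> Delta M" and x: "x \<in> Delta N"
  shows "step L u x \<in> Delta N"
proof -
  obtain j i where j: "j < M" "u = col (1\<^sub>m M) j" and i: "i < N" "x = col (1\<^sub>m N) i"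
    using u x by (auto simp: Delta_def)
  have "j * N + i < Suc j * N" using i by simp
  also have "\<dots> \<le> M * N" using j by (intro mult_le_mono1) simp
  finally have lt: "j * N + i < N * M" by (simp add: mult.commute)
  have "L \<in> carrier_mat N (N * M)" and sub: "set (cols L) \<subseteq> Delta N"
    using L by (auto simp: logical_mats_def)
  then have "col L (j * N + i) \<in> set (cols L)"
    using lt by (auto simp: cols_def)
  then show ?thesis
    using sub step_col[OF \<open>L \<in> carrier_mat N (N * M)\<close> j(1) i(1)] j i by auto
qed

section \<open>Confused pairs of states\<close>

definition run :: "real mat \<Rightarrow> real vec \<Rightarrow> real vec list \<Rightarrow> real vec" where
  "run L x U = foldl (\<lambda>z u. step L u z) x U"

lemma run_Nil [simp]: "run L x [] = x"
  and run_Cons [simp]: "run L x (u # U) = run L (step L u x) U"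
  by (simp_all add: run_def)

lemma state_traj_nth_length: "state_traj L x U ! length U = run L x U"
  by (induction U arbitrary: x) auto

lemma run_in_Delta:
  assumes "L \<in> logical_mats N (N * M)" and "set U \<subseteq> Delta M" and "x \<in> Delta N"
  shows "run L x U \<in> Delta N"
  using assms(2,3) by (induction U arbitrary: x) (auto intro: step_in_Delta[OF assms(1)])

definition confused :: "real mat \<Rightarrow> real mat \<Rightarrow> real vec list \<Rightarrow> real vec \<Rightarrow> real vec \<Rightarrow> bool" where
  "confused L H U x x' \<longleftrightarrow>
     run L x U \<noteq> run L x' U \<and> output_traj H L x U = output_traj H L x' U"

lemma confused_Nil [simp]: "confused L H [] x x' \<longleftrightarrow> x \<noteq> x' \<and> H *\<^sub>v x = H *\<^sub>v x'"
  by (simp add: confused_def output_traj_def)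

lemma confused_Cons [simp]:
  "confused L H (u # U) x x' \<longleftrightarrow>
     H *\<^sub>v x = H *\<^sub>v x' \<and> confused L H U (step L u x) (step L u x')"
  by (auto simp: confused_def output_traj_def)

lemma confused_imp_confused_Nil:
  assumes "confused L H U x x'"
  shows "confused L H [] x x'"
  using assms by (cases U) (auto simp: confused_def output_traj_def)

text \<open>This makes resolution permanent: if \<open>U\<close> does not confuse a pair, no extension of \<open>U\<close> does.\<close>

lemma confused_append:
  "confused L H (U @ V) x x' \<longleftrightarrow>
     confused L H U x x' \<and> confused L H V (run L x U) (run L x' U)"
proof (induction U arbitrary: x x')
  case Nil
  show ?case using confused_imp_confused_Nil[of L H V x x'] by auto
qed auto

lemma reconstructible_iff:
  "reconstructible N M L H \<longleftrightarrow>
     (\<exists>U. set U \<subseteq> Delta M \<and> (\<forall>x \<in> Delta N. \<forall>x' \<in> Delta N. \<not> confused L H U x x'))"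
proof -
  have "x \<noteq> x'" if "run L x U \<noteq> run L x' U" for x x' U
    using that by auto
  then show ?thesis
    unfolding reconstructible_def words_def confused_def
    by (auto simp flip: state_traj_nth_length) (metis+)
qed

text \<open>The word is built by adding the pairs of \<open>S\<close> one at a time. The resolving words are
  assumed for all pairs of states and not only for those in \<open>S\<close>, because the word appended for a new pair has to
  resolve the pair into which the word built so far has driven it.\<close>

lemma common_resolving_word:
  assumes L: "L \<in> logical_mats N (N * M)"
    and each: "\<And>x x'. x \<in> Delta N \<Longrightarrow> x' \<in> Delta N \<Longrightarrow>
                 \<exists>U. set U \<subseteq> Delta M \<and> \<not> confused L H U x x'"
    and "finite S" and "S \<subseteq> Delta N \<times> Delta N"
  shows "\<exists>U. set U \<subseteq> Delta M \<and> (\<forall>(x, x') \<in> S. \<not> confused L H U x x')"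
  using assms(3,4)
proof (induction S rule: finite_induct)
  case empty
  show ?case by (intro exI[of _ "[]"]) auto
next
  case (insert v S)
  obtain y y' where v: "v = (y, y')" by force
  from insert obtain U where U: "set U \<subseteq> Delta M" "\<forall>(x, x') \<in> S. \<not> confused L H U x x'"
    by auto
  have "run L y U \<in> Delta N" "run L y' U \<in> Delta N"
    using insert.prems v run_in_Delta[OF L U(1)] by auto
  then obtain V where V: "set V \<subseteq> Delta M" "\<not> confused L H V (run L y U) (run L y' U)"
    using each by blast
  show ?case
    using U V v by (intro exI[of _ "U @ V"]) (auto simp: confused_append)
qed

section \<open>Complete subgraphs as closed sets of pairs\<close>

lemma pair_step_iff:
  "pair_step L u {x, x'} w \<longleftrightarrow> w = step L u ` {x, x'}"
  unfolding pair_step_def by (auto simp: doubleton_eq_iff)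

lemma doubleton_in_pair_verts_iff:
  "{x, x'} \<in> pair_verts N H \<longleftrightarrow>
     x \<in> Delta N \<and> x' \<in> Delta N \<and> x \<noteq> x' \<and> H *\<^sub>v x = H *\<^sub>v x'"
  unfolding pair_verts_def by (auto simp: doubleton_eq_iff)

lemma pair_vertsE:
  assumes "v \<in> pair_verts N H"
  obtains x x' where "v = {x, x'}" "x \<in> Delta N" "x' \<in> Delta N" "x \<noteq> x'" "H *\<^sub>v x = H *\<^sub>v x'"
  using assms unfolding pair_verts_def by blast

text \<open>Each input sends a pair to exactly one set of states, so the union of the weights of the
  edges leaving a vertex consists of the inputs whose image lies in the subgraph.\<close>

lemma outdegree_subgraph:
  assumes V': "V' \<subseteq> pair_verts N H" and v: "v \<in> V'"
  shows "outdegree (subgraph_on (weighted_pair_graph N M L H) V') v =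
           card {u \<in> Delta M. step L u ` v \<in> V'}"
proof -
  obtain x x' where x: "v = {x, x'}"
    using V' v by (blast elim: pair_vertsE)
  have step: "pair_step L u v w \<longleftrightarrow> w = step L u ` v" for u w
    unfolding x by (rule pair_step_iff)
  show ?thesis
    using V' v unfolding outdegree_def subgraph_on_def weighted_pair_graph_def
    by (intro arg_cong[where f = card]) (auto simp: step)
qed

lemma has_complete_subgraph_iff:
  "has_complete_subgraph (weighted_pair_graph N M L H) \<longleftrightarrow>
     (\<exists>V'. V' \<subseteq> pair_verts N H \<and> V' \<noteq> {} \<and> (\<forall>v \<in> V'. \<forall>u \<in> Delta M. step L u ` v \<in> V'))"
proof -
  have "card {u \<in> Delta M. P u} = card (Delta M) \<longleftrightarrow> (\<forall>u \<in> Delta M. P u)" for P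
    using card_subset_eq[OF finite_Delta, of "{u \<in> Delta M. P u}" M]
    by (auto intro: arg_cong[where f = card])
  then have "complete_wgraph (subgraph_on (weighted_pair_graph N M L H) V') \<longleftrightarrow>
      (\<forall>v \<in> V'. \<forall>u \<in> Delta M. step L u ` v \<in> V')" if "V' \<subseteq> pair_verts N H" for V'
    unfolding complete_wgraph_def using outdegree_subgraph[OF that]
    by (simp add: subgraph_on_def weighted_pair_graph_def)
  moreover have "verts (weighted_pair_graph N M L H) = pair_verts N H"
    by (simp add: weighted_pair_graph_def)
  ultimately show ?thesis
    unfolding has_complete_subgraph_def by metis
qed

lemma confused_in_closed_set:
  assumes V': "V' \<subseteq> pair_verts N H"
    and closed: "\<And>v u. v \<in> V' \<Longrightarrow> u \<in> Delta M \<Longrightarrow> step L u ` v \<in> V'"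
    and "{x, x'} \<in> V'" and "set U \<subseteq> Delta M"
  shows "confused L H U x x'"
  using assms(3,4)
proof (induction U arbitrary: x x')
  case Nil
  then have "{x, x'} \<in> pair_verts N H" using V' by blast
  then show ?case by (simp add: doubleton_in_pair_verts_iff)
next
  case (Cons u U)
  have "{step L u x, step L u x'} \<in> V'"
    using closed[of "{x, x'}" u] Cons.prems by auto
  moreover have "H *\<^sub>v x = H *\<^sub>v x'"
    using V' Cons.prems doubleton_in_pair_verts_iff by blast
  ultimately show ?case using Cons by auto
qed

section \<open>The characterisation of reconstructibility\<close>

theorem theorem4p2:
  fixes N M Q :: nat and L H :: "real mat"
  assumes "N > 0" and "M > 0" and "Q > 0"
    and "L \<in> logical_mats N (N * M)"
    and "H \<in> logical_mats Q N"
  shows "\<not> reconstructible N M L H \<longleftrightarrow>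
         has_complete_subgraph (weighted_pair_graph N M L H)"
proof
  assume "has_complete_subgraph (weighted_pair_graph N M L H)"
  then obtain V' v where V': "V' \<subseteq> pair_verts N H" "v \<in> V'"
    and closed: "\<And>v u. v \<in> V' \<Longrightarrow> u \<in> Delta M \<Longrightarrow> step L u ` v \<in> V'"
    unfolding has_complete_subgraph_iff by blast
  obtain x x' where x: "v = {x, x'}" "x \<in> Delta N" "x' \<in> Delta N"
    using V' by (blast elim: pair_vertsE)
  have "confused L H U x x'" if "set U \<subseteq> Delta M" for U
    using confused_in_closed_set[OF V'(1) closed _ that] V'(2) x(1) by blast
  then show "\<not> reconstructible N M L H"
    unfolding reconstructible_iff using x(2,3) by blast
next
  assume not_rec: "\<not> reconstructible N M L H"
  define unresolvable where
    "unresolvable x x' \<longleftrightarrow> (\<forall>U. set U \<subseteq> Delta M \<longrightarrow> confused L H U x x')" for x x'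
  define V' where
    "V' = {{x, x'} | x x'. x \<in> Delta N \<and> x' \<in> Delta N \<and> unresolvable x x'}"
  \<comment> \<open>The empty word shows that an unresolvable pair is a vertex.\<close>
  have "x \<noteq> x' \<and> H *\<^sub>v x = H *\<^sub>v x'" if "unresolvable x x'" for x x'
    using that[unfolded unresolvable_def, rule_format, of "[]"] by simp
  then have sub: "V' \<subseteq> pair_verts N H"
    unfolding V'_def pair_verts_def by blast
  have "V' \<noteq> {}"
  proof
    assume "V' = {}"
    then have each: "\<exists>U. set U \<subseteq> Delta M \<and> \<not> confused L H U x x'"
      if "x \<in> Delta N" "x' \<in> Delta N" for x x'
      using that unfolding V'_def unresolvable_def by blast
    have "\<exists>U. set U \<subseteq> Delta M \<and> (\<forall>(x, x') \<in> Delta N \<times> Delta N. \<not> confused L H U x x')"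
      by (rule common_resolving_word[OF assms(4) each]) (auto simp: finite_Delta)
    then show False
      using not_rec unfolding reconstructible_iff by auto
  qed
  moreover have "step L u ` v \<in> V'" if v: "v \<in> V'" and u: "u \<in> Delta M" for v u
  proof -
    obtain x x' where x: "v = {x, x'}" "x \<in> Delta N" "x' \<in> Delta N" "unresolvable x x'"
      using v unfolding V'_def by blast
    \<comment> \<open>A word that resolved the successors would, prefixed by \<open>u\<close>, resolve \<open>x\<close> and \<open>x'\<close>.\<close>
    have "confused L H U (step L u x) (step L u x')" if "set U \<subseteq> Delta M" for U
      using x(4)[unfolded unresolvable_def, rule_format, of "u # U"] that u by simp
    then have "unresolvable (step L u x) (step L u x')"
      unfolding unresolvable_def by blast
    then show ?thesis
      using x step_in_Delta[OF assms(4) u] unfolding V'_def by auto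
  qed
  ultimately show "has_complete_subgraph (weighted_pair_graph N M L H)"
    unfolding has_complete_subgraph_iff using sub by blast
qed

end
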